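(* Let $c$ be a GCL command and $f$ a label with $\mathrm{okf}(c,f)$, and let $an$ be a valid annotation of the automaton $\mathrm{aut}(c,f)$ for $\{P\}\{Q\}$. Then $c:\{P\}\{Q\}$ is provable in HL+, using only assertions derived from $an$: boolean combinations of the sets $an(i)$, boolean expressions occurring in $c$, and equality tests $pc=n$ of a fresh variable $pc$ with numeric literals, together with substitution instances $an(i)[x:=e]$ for assignments $x:=e$ occurring in $c$.
   Context: Stores: total functions $\mathit{Var}\to\mathbb{Z}$; assertions are sets of stores (a boolean expression denotes the set of stores where it is true; $\wedge,\neg,\Rightarrow$ are intersection, complement, inclusion). $P[x:=e]=\{s\mid s[x\mapsto\llbracket e\rrbracket(s)]\in P\}$; $\forall x.P=\{s\mid\forall v.\ s[x\mapsto v]\in P\}$; $\mathrm{indep}(x,P)$ means $P=\{s\mid\exists v.\,s[x\mapsto v]\in P\}$. GCL commands: $c::=\mathsf{skip}^n\mid x:=^n e\mid\mathsf{havoc}^n x\mid c;c\mid\mathsf{if}^n gcs\,\mathsf{fi}\mid\mathsf{do}^n gcs\,\mathsf{od}$, labels $n\in\mathbb{Z}$, $gcs$ nonempty lists of guarded commands $e\to c$, $\mathrm{enab}(gcs)$ the disjunction of the guards; commands well typed, each $\mathsf{if}\,gcs\,\mathsf{fi}$ having $\mathrm{enab}(gcs)$ valid. $\mathrm{labs}(c)$: labels of $c$; $\mathrm{lab}(c)$: label of $c$ with $\mathrm{lab}(c;d)=\mathrm{lab}(c)$; $\mathrm{okf}(c,f)$: labels of $c$ positive and pairwise distinct, $f\notin\mathrm{labs}(c)$;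 $\mathrm{sub}(n,c)$: the subcommand of $c$, not of the form $d;d'$, with label $n$. Small-step semantics: $\langle\mathsf{havoc}^n x,s\rangle\rightsquigarrow\langle\mathsf{skip}^{-n},s[x\mapsto v]\rangle$ ($v\in\mathbb{Z}$); $\langle x:=^n e,s\rangle\rightsquigarrow\langle\mathsf{skip}^{-n},s[x\mapsto\llbracket e\rrbracket(s)]\rangle$; $\langle\mathsf{skip}^n;c,s\rangle\rightsquigarrow\langle c,s\rangle$; $\langle\mathsf{if}^n gcs\,\mathsf{fi},s\rangle\rightsquigarrow\langle c,s\rangle$ if $e\to c\in gcs$ with $e$ true in $s$; $\langle\mathsf{do}^n gcs\,\mathsf{od},s\rangle\rightsquigarrow\langle c;\mathsf{do}^n gcs\,\mathsf{od},s\rangle$ if $e\to c\in gcs$ with $e$ true; $\langle\mathsf{do}^n gcs\,\mathsf{od},s\rangle\rightsquigarrow\langle\mathsf{skip}^{-n},s\rangle$ if $\mathrm{enab}(gcs)$ false in $s$; $\langle c;b,s\rangle\rightsquigarrow\langle d;b,t\rangle$ if $\langle c,s\rangle\rightsquigarrow\langle d,t\rangle$. $\mathrm{fsuc}(n,c,f)$: $\mathrm{fsuc}(n,c;d,f)=\mathrm{fsuc}(n,c,\mathrm{lab}(d))$ if $n\in\mathrm{labs}(c)$, else $\mathrm{fsuc}(n,d,f)$; equals $f$ when $n$ is the label of the whole if/do/skip/assignment/havoc; $\mathrm{fsuc}(m,\mathsf{if}^n gcs\,\mathsf{fi},f)=\mathrm{fsuc}(m,c,f)$ and $\mathrm{fsuc}(m,\mathsf{do}^n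 gcs\,\mathsf{od},f)=\mathrm{fsuc}(m,c,n)$ when $e\to c\in gcs$ and $m\in\mathrm{labs}(c)$. Automaton $\mathrm{aut}(c,f)$: control points $\mathrm{labs}(c)\cup\{f\}$, stores $\mathit{Var}\to\mathbb{Z}$, initial $\mathrm{lab}(c)$, final $f$, $(n,s)\to(m,t)$ iff (i) $\langle\mathrm{sub}(n,c),s\rangle\rightsquigarrow\langle d,t\rangle$, $\mathrm{lab}(d)>0$, $m=\mathrm{lab}(d)$; or (ii) $\langle\mathrm{sub}(n,c),s\rangle\rightsquigarrow\langle d,t\rangle$, $\mathrm{lab}(d)<0$, $m=\mathrm{fsuc}(n,c,f)$; or (iii) $\mathrm{sub}(n,c)=\mathsf{skip}^n$, $m=\mathrm{fsuc}(n,c,f)$, $t=s$. An annotation of $\mathrm{aut}(c,f)$ for $\{P\}\{Q\}$ is a map $an$ from control points to sets of stores with $an(\mathrm{lab}(c))=P$, $an(f)=Q$; it is valid if $s\in an(n)$ and $(n,s)\to(m,t)$ imply $t\in an(m)$. HL+ derives judgments $c:\{P\}\{Q\}$ by the rules: Skip $\mathsf{skip}:\{P\}\{P\}$; Asgn $x:=e:\{P[x:=e]\}\{P\}$; Havoc $\mathsf{havoc}\,x:\{\forall x.P\}\{P\}$; Seq from $c:\{P\}\{R\}$, $d:\{R\}\{Q\}$ infer $c;d:\{P\}\{Q\}$; If from $c:\{P\wedge e\}\{Q\}$ for all $e\to c$ in $gcs$ infer $\mathsf{if}\,gcs\,\mathsf{fi}:\{P\}\{Q\}$; Do from $c:\{e\wedge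 P\}\{P\}$ for all $e\to c$ in $gcs$ infer $\mathsf{do}\,gcs\,\mathsf{od}:\{P\}\{P\wedge\neg\mathrm{enab}(gcs)\}$; Conseq from $P\Rightarrow P'$, $c:\{P'\}\{Q'\}$, $Q'\Rightarrow Q$ infer $c:\{P\}\{Q\}$; Ghost from $c:\{P\}\{Q\}$, $\mathrm{ghost}(x,c)$ ($x$ occurs in $c$ only as target of assignments to $x$ and of $\mathsf{havoc}\,x$), $\mathrm{indep}(x,P)$, $\mathrm{indep}(x,Q)$ infer $\mathrm{erase}(x,c):\{P\}\{Q\}$ (erase replaces those assignments and havocs by $\mathsf{skip}$); Rewrite from $c:\{P\}\{Q\}$ and $c\simeq d$ infer $d:\{P\}\{Q\}$. Here $c\simeq d$ means $\mathrm{Hyp}\vdash\lfloor c\rfloor=\lfloor d\rfloor$: $\lfloor\cdot\rfloor$ translates commands to KAT expressions ($\lfloor\mathsf{skip}\rfloor=1$, assignments/havocs and primitive boolean expressions to primitive symbols, $\wedge,\vee,\neg$ to $;,+,\neg$, $\lfloor c;d\rfloor=\lfloor c\rfloor;\lfloor d\rfloor$, $\lfloor\mathsf{if}\,gcs\,\mathsf{fi}\rfloor=\lfloor gcs\rfloor=\sum_{e\to c\in gcs}\lfloor e\rfloor;\lfloor c\rfloor$, $\lfloor\mathsf{do}\,gcs\,\mathsf{od}\rfloor=\lfloor gcs\rfloor^*;\neg\lfloor\mathrm{enab}(gcs)\rfloor$), $\vdash$ is derivability by equational and propositional reasoning from the Kleene-algebra-with-tests axioms (idempotent semiring with Boolean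 algebra of tests and the star unfolding/induction laws $1+x;x^*=x^*$, $1+x^*;x=x^*$, $y+x;z\le z\Rightarrow x^*;y\le z$, $y+z;x\le z\Rightarrow y;x^*\le z$), and $\mathrm{Hyp}$ consists of $\lfloor e\rfloor=0$ for unsatisfiable $e$, $\lfloor e_0\rfloor;\lfloor x:=e\rfloor;\neg\lfloor e_1\rfloor=0$ when $e_0\Rightarrow e_1[x:=e]$ is valid, and $\lfloor e_0\rfloor;\lfloor\mathsf{havoc}\,x\rfloor;\neg\lfloor e_1\rfloor=0$ when $e_0\Rightarrow\forall x.e_1$ is valid.
   Formalization: The permitted assertions also include ∀x.an(i) for each havoc x occurring in c, besides those listed; without them the claim fails in general for commands containing havoc. For havoc-free commands the permitted assertions are exactly those listed. *)

theory Defs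
  imports Main
begin

section \<open>Stores, expressions and assertions\<close>

type_synonym var = string
type_synonym store = "var \<Rightarrow> int"
type_synonym assertion = "store set"
type_synonym label = int

text \<open>The expression language is parametric in its operator symbols \<open>'o\<close> and relation
  symbols \<open>'r\<close>, whose meaning is supplied by an interpretation. Numeric literals and equality
  are always present, since commands and assertions about the fresh variable \<open>pc\<close> need them.
  Well-typedness of commands is enforced by the separation into integer and boolean
  expressions.\<close>

record ('o, 'r) interp =
  op_fun :: "'o \<Rightarrow> int list \<Rightarrow> int"
  rel_fun :: "'r \<Rightarrow> int list \<Rightarrow> bool"

datatype 'o iexp =
    Num int
  | Var var
  | Op 'o "'o iexp list"

datatype ('o, 'r) prim =
    Eq "'o iexp" "'o iexp"
  | Rel 'r "'o iexp list"

datatype ('o, 'r) bexp =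
    BPrim "('o, 'r) prim"
  | BAnd "('o, 'r) bexp" "('o, 'r) bexp"
  | BOr "('o, 'r) bexp" "('o, 'r) bexp"
  | BNot "('o, 'r) bexp"

fun ival :: "('o, 'r) interp \<Rightarrow> 'o iexp \<Rightarrow> store \<Rightarrow> int" where
  "ival I (Num k) s = k"
| "ival I (Var x) s = s x"
| "ival I (Op g es) s = op_fun I g (map (\<lambda>e. ival I e s) es)"

fun pval :: "('o, 'r) interp \<Rightarrow> ('o, 'r) prim \<Rightarrow> store \<Rightarrow> bool" where
  "pval I (Eq e e') s = (ival I e s = ival I e' s)"
| "pval I (Rel r es) s = rel_fun I r (map (\<lambda>e. ival I e s) es)"

fun bval :: "('o, 'r) interp \<Rightarrow> ('o, 'r) bexp \<Rightarrow> store \<Rightarrow> bool" where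
  "bval I (BPrim p) s = pval I p s"
| "bval I (BAnd b b') s = (bval I b s \<and> bval I b' s)"
| "bval I (BOr b b') s = (bval I b s \<or> bval I b' s)"
| "bval I (BNot b) s = (\<not> bval I b s)"

definition bset :: "('o, 'r) interp \<Rightarrow> ('o, 'r) bexp \<Rightarrow> assertion" where
  "bset I b = {s. bval I b s}"

fun ivars :: "'o iexp \<Rightarrow> var set" where
  "ivars (Num k) = {}"
| "ivars (Var x) = {x}"
| "ivars (Op g es) = (\<Union>e \<in> set es. ivars e)"

fun pvars :: "('o, 'r) prim \<Rightarrow> var set" where
  "pvars (Eq e e') = ivars e \<union> ivars e'"
| "pvars (Rel r es) = (\<Union>e \<in> set es. ivars e)"

fun bvars :: "('o, 'r) bexp \<Rightarrow> var set" where
  "bvars (BPrim p) = pvars p"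
| "bvars (BAnd b b') = bvars b \<union> bvars b'"
| "bvars (BOr b b') = bvars b \<union> bvars b'"
| "bvars (BNot b) = bvars b"

fun bsubexps :: "('o, 'r) bexp \<Rightarrow> ('o, 'r) bexp set" where
  "bsubexps (BPrim p) = {BPrim p}"
| "bsubexps (BAnd b b') = {BAnd b b'} \<union> bsubexps b \<union> bsubexps b'"
| "bsubexps (BOr b b') = {BOr b b'} \<union> bsubexps b \<union> bsubexps b'"
| "bsubexps (BNot b) = {BNot b} \<union> bsubexps b"

definition subst :: "('o, 'r) interp \<Rightarrow> assertion \<Rightarrow> var \<Rightarrow> 'o iexp \<Rightarrow> assertion" where
  "subst I P x e = {s. s(x := ival I e s) \<in> P}"

definition all_var :: "var \<Rightarrow> assertion \<Rightarrow> assertion" where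
  "all_var x P = {s. \<forall>v. s(x := v) \<in> P}"

definition indep :: "var \<Rightarrow> assertion \<Rightarrow> bool" where
  "indep x P \<longleftrightarrow> P = {s. \<exists>v. s(x := v) \<in> P}"


section \<open>Guarded commands\<close>

datatype ('o, 'r) cmd =
    Skip label
  | Asgn label var "'o iexp"
  | Havoc label var
  | Seq "('o, 'r) cmd" "('o, 'r) cmd"
  | IfFi label "(('o, 'r) bexp \<times> ('o, 'r) cmd) list"
  | DoOd label "(('o, 'r) bexp \<times> ('o, 'r) cmd) list"

type_synonym ('o, 'r) gcs = "(('o, 'r) bexp \<times> ('o, 'r) cmd) list"

text \<open>The value for the empty list is a false expression; it never matters, since lists of
  guarded commands are nonempty by \<open>wf_cmd\<close> below.\<close>

fun enab :: "('o, 'r) gcs \<Rightarrow> ('o, 'r) bexp" where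
  "enab [] = BPrim (Eq (Num 0) (Num 1))"
| "enab [(e, c)] = e"
| "enab ((e, c) # gcs) = BOr e (enab gcs)"

fun wf_cmd :: "('o, 'r) interp \<Rightarrow> ('o, 'r) cmd \<Rightarrow> bool" where
  "wf_cmd I (Skip n) = True"
| "wf_cmd I (Asgn n x e) = True"
| "wf_cmd I (Havoc n x) = True"
| "wf_cmd I (Seq c d) = (wf_cmd I c \<and> wf_cmd I d)"
| "wf_cmd I (IfFi n gcs) =
    (gcs \<noteq> [] \<and> (\<forall>s. bval I (enab gcs) s) \<and> (\<forall>(e, c) \<in> set gcs. wf_cmd I c))"
| "wf_cmd I (DoOd n gcs) = (gcs \<noteq> [] \<and> (\<forall>(e, c) \<in> set gcs. wf_cmd I c))"

fun label_list :: "('o, 'r) cmd \<Rightarrow> label list" where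
  "label_list (Skip n) = [n]"
| "label_list (Asgn n x e) = [n]"
| "label_list (Havoc n x) = [n]"
| "label_list (Seq c d) = label_list c @ label_list d"
| "label_list (IfFi n gcs) = n # concat (map (\<lambda>(e, c). label_list c) gcs)"
| "label_list (DoOd n gcs) = n # concat (map (\<lambda>(e, c). label_list c) gcs)"

definition labs :: "('o, 'r) cmd \<Rightarrow> label set" where
  "labs c = set (label_list c)"

fun lab :: "('o, 'r) cmd \<Rightarrow> label" where
  "lab (Skip n) = n"
| "lab (Asgn n x e) = n"
| "lab (Havoc n x) = n"
| "lab (Seq c d) = lab c"
| "lab (IfFi n gcs) = n"
| "lab (DoOd n gcs) = n"

definition okf :: "('o, 'r) cmd \<Rightarrow> label \<Rightarrow> bool" where
  "okf c f \<longleftrightarrow> (\<forall>n \<in> labs c. n > 0) \<and> distinct (label_list c) \<and> f \<notin> labs c"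

fun subcmds :: "('o, 'r) cmd \<Rightarrow> ('o, 'r) cmd set" where
  "subcmds (Skip n) = {Skip n}"
| "subcmds (Asgn n x e) = {Asgn n x e}"
| "subcmds (Havoc n x) = {Havoc n x}"
| "subcmds (Seq c d) = {Seq c d} \<union> subcmds c \<union> subcmds d"
| "subcmds (IfFi n gcs) = {IfFi n gcs} \<union> (\<Union>(e, c) \<in> set gcs. subcmds c)"
| "subcmds (DoOd n gcs) = {DoOd n gcs} \<union> (\<Union>(e, c) \<in> set gcs. subcmds c)"

fun is_seq :: "('o, 'r) cmd \<Rightarrow> bool" where
  "is_seq (Seq c d) = True"
| "is_seq _ = False"

definition sub :: "label \<Rightarrow> ('o, 'r) cmd \<Rightarrow> ('o, 'r) cmd" where
  "sub n c = (THE d. d \<in> subcmds c \<and> \<not> is_seq d \<and> lab d = n)"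

fun cvars :: "('o, 'r) cmd \<Rightarrow> var set" where
  "cvars (Skip n) = {}"
| "cvars (Asgn n x e) = {x} \<union> ivars e"
| "cvars (Havoc n x) = {x}"
| "cvars (Seq c d) = cvars c \<union> cvars d"
| "cvars (IfFi n gcs) = (\<Union>(e, c) \<in> set gcs. bvars e \<union> cvars c)"
| "cvars (DoOd n gcs) = (\<Union>(e, c) \<in> set gcs. bvars e \<union> cvars c)"

fun bexps :: "('o, 'r) cmd \<Rightarrow> ('o, 'r) bexp set" where
  "bexps (Skip n) = {}"
| "bexps (Asgn n x e) = {}"
| "bexps (Havoc n x) = {}"
| "bexps (Seq c d) = bexps c \<union> bexps d"
| "bexps (IfFi n gcs) = (\<Union>(e, c) \<in> set gcs. bsubexps e \<union> bexps c)"
| "bexps (DoOd n gcs) = (\<Union>(e, c) \<in> set gcs. bsubexps e \<union> bexps c)"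


section \<open>Small-step semantics and the automaton of a command\<close>

inductive step :: "('o, 'r) interp \<Rightarrow> ('o, 'r) cmd \<times> store \<Rightarrow> ('o, 'r) cmd \<times> store \<Rightarrow> bool"
  for I :: "('o, 'r) interp" where
  step_havoc: "step I (Havoc n x, s) (Skip (- n), s(x := v))"
| step_asgn: "step I (Asgn n x e, s) (Skip (- n), s(x := ival I e s))"
| step_seq_skip: "step I (Seq (Skip n) c, s) (c, s)"
| step_if: "(e, c) \<in> set gcs \<Longrightarrow> bval I e s \<Longrightarrow> step I (IfFi n gcs, s) (c, s)"
| step_do: "(e, c) \<in> set gcs \<Longrightarrow> bval I e s \<Longrightarrow>
    step I (DoOd n gcs, s) (Seq c (DoOd n gcs), s)"
| step_do_end: "\<not> bval I (enab gcs) s \<Longrightarrow> step I (DoOd n gcs, s) (Skip (- n), s)"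
| step_seq: "step I (c, s) (d, t) \<Longrightarrow> step I (Seq c b, s) (Seq d b, t)"

text \<open>Only meaningful for \<open>m \<in> labs c\<close>; the equation for the empty list is never reached then.\<close>

fun fsuc :: "label \<Rightarrow> ('o, 'r) cmd \<Rightarrow> label \<Rightarrow> label"
  and fsuc_gcs :: "label \<Rightarrow> ('o, 'r) gcs \<Rightarrow> label \<Rightarrow> label" where
  "fsuc m (Skip n) f = f"
| "fsuc m (Asgn n x e) f = f"
| "fsuc m (Havoc n x) f = f"
| "fsuc m (Seq c d) f = (if m \<in> labs c then fsuc m c (lab d) else fsuc m d f)"
| "fsuc m (IfFi n gcs) f = (if m = n then f else fsuc_gcs m gcs f)"
| "fsuc m (DoOd n gcs) f = (if m = n then f else fsuc_gcs m gcs n)"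
| "fsuc_gcs m [] f = f"
| "fsuc_gcs m ((e, c) # gcs) f = (if m \<in> labs c then fsuc m c f else fsuc_gcs m gcs f)"

record automaton =
  ctrl :: "label set"
  initial :: label
  final :: label
  transition :: "label \<times> store \<Rightarrow> label \<times> store \<Rightarrow> bool"

definition aut_step ::
  "('o, 'r) interp \<Rightarrow> ('o, 'r) cmd \<Rightarrow> label \<Rightarrow> label \<times> store \<Rightarrow> label \<times> store \<Rightarrow> bool" where
  "aut_step I c f = (\<lambda>(n, s) (m, t). n \<in> labs c \<and>
     ((\<exists>d. step I (sub n c, s) (d, t) \<and> lab d > 0 \<and> m = lab d)
      \<or> (\<exists>d. step I (sub n c, s) (d, t) \<and> lab d < 0 \<and> m = fsuc n c f)
      \<or> (sub n c = Skip n \<and> m = fsuc n c f \<and> t = s)))"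

definition aut :: "('o, 'r) interp \<Rightarrow> ('o, 'r) cmd \<Rightarrow> label \<Rightarrow> automaton" where
  "aut I c f = \<lparr>ctrl = labs c \<union> {f}, initial = lab c, final = f, transition = aut_step I c f\<rparr>"

text \<open>Annotations are maps on control points; values outside \<open>ctrl\<close> are irrelevant.\<close>

definition annotation :: "automaton \<Rightarrow> (label \<Rightarrow> assertion) \<Rightarrow> assertion \<Rightarrow> assertion \<Rightarrow> bool" where
  "annotation M an P Q \<longleftrightarrow> an (initial M) = P \<and> an (final M) = Q"

definition valid_annotation :: "automaton \<Rightarrow> (label \<Rightarrow> assertion) \<Rightarrow> bool" where
  "valid_annotation M an \<longleftrightarrow>
    (\<forall>n \<in> ctrl M. \<forall>m \<in> ctrl M. \<forall>s t. s \<in> an n \<longrightarrow> transition M (n, s) (m, t) \<longrightarrow> t \<in> an m)"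


section \<open>Kleene algebra with tests and command equivalence\<close>

text \<open>Terms are one-sorted as in KAT, where tests share \<open>0, 1, +, ;\<close> with all other terms;
  negation is meant for tests only, which \<open>is_test\<close> delimits.\<close>

datatype 'o action = AAsgn var "'o iexp" | AHavoc var

datatype ('o, 'r) kat =
    KZero
  | KOne
  | KTest "('o, 'r) prim"
  | KAct "'o action"
  | KPlus "('o, 'r) kat" "('o, 'r) kat"
  | KSeq "('o, 'r) kat" "('o, 'r) kat"
  | KStar "('o, 'r) kat"
  | KNeg "('o, 'r) kat"

fun is_test :: "('o, 'r) kat \<Rightarrow> bool" where
  "is_test KZero = True"
| "is_test KOne = True"
| "is_test (KTest p) = True"
| "is_test (KAct a) = False"
| "is_test (KPlus x y) = (is_test x \<and> is_test y)"
| "is_test (KSeq x y) = (is_test x \<and> is_test y)"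
| "is_test (KStar x) = False"
| "is_test (KNeg x) = is_test x"

text \<open>Derivability of equations from hypotheses \<open>H\<close>. The axioms are universal Horn clauses, so
  closing under them and the rules of equality gives all derivable equations. The order
  \<open>x \<le> y\<close> is \<open>x + y = y\<close>.\<close>

inductive kat_eq ::
  "(('o, 'r) kat \<times> ('o, 'r) kat) set \<Rightarrow> ('o, 'r) kat \<Rightarrow> ('o, 'r) kat \<Rightarrow> bool"
  for H :: "(('o, 'r) kat \<times> ('o, 'r) kat) set" where
  kat_hyp: "(x, y) \<in> H \<Longrightarrow> kat_eq H x y"
| kat_refl: "kat_eq H x x"
| kat_sym: "kat_eq H x y \<Longrightarrow> kat_eq H y x"
| kat_trans: "kat_eq H x y \<Longrightarrow> kat_eq H y z \<Longrightarrow> kat_eq H x z"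
| kat_cong_plus: "kat_eq H x x' \<Longrightarrow> kat_eq H y y' \<Longrightarrow> kat_eq H (KPlus x y) (KPlus x' y')"
| kat_cong_seq: "kat_eq H x x' \<Longrightarrow> kat_eq H y y' \<Longrightarrow> kat_eq H (KSeq x y) (KSeq x' y')"
| kat_cong_star: "kat_eq H x x' \<Longrightarrow> kat_eq H (KStar x) (KStar x')"
| kat_cong_neg: "is_test p \<Longrightarrow> is_test q \<Longrightarrow> kat_eq H p q \<Longrightarrow> kat_eq H (KNeg p) (KNeg q)"
| kat_plus_assoc: "kat_eq H (KPlus (KPlus x y) z) (KPlus x (KPlus y z))"
| kat_plus_comm: "kat_eq H (KPlus x y) (KPlus y x)"
| kat_plus_zero: "kat_eq H (KPlus x KZero) x"
| kat_plus_idem: "kat_eq H (KPlus x x) x"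
| kat_seq_assoc: "kat_eq H (KSeq (KSeq x y) z) (KSeq x (KSeq y z))"
| kat_seq_one_left: "kat_eq H (KSeq KOne x) x"
| kat_seq_one_right: "kat_eq H (KSeq x KOne) x"
| kat_seq_zero_left: "kat_eq H (KSeq KZero x) KZero"
| kat_seq_zero_right: "kat_eq H (KSeq x KZero) KZero"
| kat_distrib_left: "kat_eq H (KSeq x (KPlus y z)) (KPlus (KSeq x y) (KSeq x z))"
| kat_distrib_right: "kat_eq H (KSeq (KPlus x y) z) (KPlus (KSeq x z) (KSeq y z))"
| kat_star_unfold_left: "kat_eq H (KPlus KOne (KSeq x (KStar x))) (KStar x)"
| kat_star_unfold_right: "kat_eq H (KPlus KOne (KSeq (KStar x) x)) (KStar x)"
| kat_star_induct_left: "kat_eq H (KPlus (KPlus y (KSeq x z)) z) z \<Longrightarrow>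
    kat_eq H (KPlus (KSeq (KStar x) y) z) z"
| kat_star_induct_right: "kat_eq H (KPlus (KPlus y (KSeq z x)) z) z \<Longrightarrow>
    kat_eq H (KPlus (KSeq y (KStar x)) z) z"
| kat_test_comm: "is_test p \<Longrightarrow> is_test q \<Longrightarrow> kat_eq H (KSeq p q) (KSeq q p)"
| kat_test_idem: "is_test p \<Longrightarrow> kat_eq H (KSeq p p) p"
| kat_test_distrib: "is_test p \<Longrightarrow> is_test q \<Longrightarrow> is_test r \<Longrightarrow>
    kat_eq H (KPlus p (KSeq q r)) (KSeq (KPlus p q) (KPlus p r))"
| kat_test_plus_one: "is_test p \<Longrightarrow> kat_eq H (KPlus p KOne) KOne"
| kat_test_contradiction: "is_test p \<Longrightarrow> kat_eq H (KSeq p (KNeg p)) KZero"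
| kat_test_excluded_middle: "is_test p \<Longrightarrow> kat_eq H (KPlus p (KNeg p)) KOne"

fun btrans :: "('o, 'r) bexp \<Rightarrow> ('o, 'r) kat" where
  "btrans (BPrim p) = KTest p"
| "btrans (BAnd b b') = KSeq (btrans b) (btrans b')"
| "btrans (BOr b b') = KPlus (btrans b) (btrans b')"
| "btrans (BNot b) = KNeg (btrans b)"

fun ctrans :: "('o, 'r) cmd \<Rightarrow> ('o, 'r) kat"
  and gtrans :: "('o, 'r) gcs \<Rightarrow> ('o, 'r) kat" where
  "ctrans (Skip n) = KOne"
| "ctrans (Asgn n x e) = KAct (AAsgn x e)"
| "ctrans (Havoc n x) = KAct (AHavoc x)"
| "ctrans (Seq c d) = KSeq (ctrans c) (ctrans d)"
| "ctrans (IfFi n gcs) = gtrans gcs"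
| "ctrans (DoOd n gcs) = KSeq (KStar (gtrans gcs)) (KNeg (btrans (enab gcs)))"
| "gtrans [] = KZero"
| "gtrans ((e, c) # gcs) = KPlus (KSeq (btrans e) (ctrans c)) (gtrans gcs)"

inductive_set Hyp :: "('o, 'r) interp \<Rightarrow> (('o, 'r) kat \<times> ('o, 'r) kat) set"
  for I :: "('o, 'r) interp" where
  hyp_unsat: "bset I e = {} \<Longrightarrow> (btrans e, KZero) \<in> Hyp I"
| hyp_asgn: "bset I e0 \<subseteq> subst I (bset I e1) x e \<Longrightarrow>
    (KSeq (KSeq (btrans e0) (KAct (AAsgn x e))) (KNeg (btrans e1)), KZero) \<in> Hyp I"
| hyp_havoc: "bset I e0 \<subseteq> all_var x (bset I e1) \<Longrightarrow>
    (KSeq (KSeq (btrans e0) (KAct (AHavoc x))) (KNeg (btrans e1)), KZero) \<in> Hyp I"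

definition cmd_equiv :: "('o, 'r) interp \<Rightarrow> ('o, 'r) cmd \<Rightarrow> ('o, 'r) cmd \<Rightarrow> bool" where
  "cmd_equiv I c d \<longleftrightarrow> kat_eq (Hyp I) (ctrans c) (ctrans d)"


section \<open>The logic HL+\<close>

fun ghost :: "var \<Rightarrow> ('o, 'r) cmd \<Rightarrow> bool" where
  "ghost x (Skip n) = True"
| "ghost x (Asgn n y e) = (x \<notin> ivars e)"
| "ghost x (Havoc n y) = True"
| "ghost x (Seq c d) = (ghost x c \<and> ghost x d)"
| "ghost x (IfFi n gcs) = (\<forall>(e, c) \<in> set gcs. x \<notin> bvars e \<and> ghost x c)"
| "ghost x (DoOd n gcs) = (\<forall>(e, c) \<in> set gcs. x \<notin> bvars e \<and> ghost x c)"

fun erase :: "var \<Rightarrow> ('o, 'r) cmd \<Rightarrow> ('o, 'r) cmd" where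
  "erase x (Skip n) = Skip n"
| "erase x (Asgn n y e) = (if y = x then Skip n else Asgn n y e)"
| "erase x (Havoc n y) = (if y = x then Skip n else Havoc n y)"
| "erase x (Seq c d) = Seq (erase x c) (erase x d)"
| "erase x (IfFi n gcs) = IfFi n (map (\<lambda>(e, c). (e, erase x c)) gcs)"
| "erase x (DoOd n gcs) = DoOd n (map (\<lambda>(e, c). (e, erase x c)) gcs)"

text \<open>\<open>hlp I A c P Q\<close>: the judgment \<open>c : {P}{Q}\<close> has an HL+ derivation in which the pre- and
  postcondition of every judgment belong to \<open>A\<close>. Plain derivability is the case
  \<open>A = UNIV\<close>. The \<open>wf_cmd\<close> conditions keep all commands in a derivation well formed.\<close>

inductive hlp ::
  "('o, 'r) interp \<Rightarrow> assertion set \<Rightarrow> ('o, 'r) cmd \<Rightarrow> assertion \<Rightarrow> assertion \<Rightarrow> bool"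
  for I :: "('o, 'r) interp" and A :: "assertion set" where
  hlp_skip: "P \<in> A \<Longrightarrow> hlp I A (Skip n) P P"
| hlp_asgn: "subst I P x e \<in> A \<Longrightarrow> P \<in> A \<Longrightarrow> hlp I A (Asgn n x e) (subst I P x e) P"
| hlp_havoc: "all_var x P \<in> A \<Longrightarrow> P \<in> A \<Longrightarrow> hlp I A (Havoc n x) (all_var x P) P"
| hlp_seq: "hlp I A c P R \<Longrightarrow> hlp I A d R Q \<Longrightarrow> hlp I A (Seq c d) P Q"
| hlp_if: "wf_cmd I (IfFi n gcs) \<Longrightarrow> P \<in> A \<Longrightarrow> Q \<in> A \<Longrightarrow>
    (\<And>e c. (e, c) \<in> set gcs \<Longrightarrow> hlp I A c (P \<inter> bset I e) Q) \<Longrightarrow>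
    hlp I A (IfFi n gcs) P Q"
| hlp_do: "wf_cmd I (DoOd n gcs) \<Longrightarrow> P \<in> A \<Longrightarrow> P \<inter> - bset I (enab gcs) \<in> A \<Longrightarrow>
    (\<And>e c. (e, c) \<in> set gcs \<Longrightarrow> hlp I A c (bset I e \<inter> P) P) \<Longrightarrow>
    hlp I A (DoOd n gcs) P (P \<inter> - bset I (enab gcs))"
| hlp_conseq: "P \<in> A \<Longrightarrow> Q \<in> A \<Longrightarrow> P \<subseteq> P' \<Longrightarrow> hlp I A c P' Q' \<Longrightarrow> Q' \<subseteq> Q \<Longrightarrow> hlp I A c P Q"
| hlp_ghost: "hlp I A c P Q \<Longrightarrow> ghost x c \<Longrightarrow> indep x P \<Longrightarrow> indep x Q \<Longrightarrow> hlp I A (erase x c) P Q"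
| hlp_rewrite: "hlp I A c P Q \<Longrightarrow> cmd_equiv I c d \<Longrightarrow> wf_cmd I d \<Longrightarrow> hlp I A d P Q"


section \<open>Assertions derived from an annotation\<close>

inductive_set bool_comb :: "assertion set \<Rightarrow> assertion set"
  for B :: "assertion set" where
  bc_base: "P \<in> B \<Longrightarrow> P \<in> bool_comb B"
| bc_compl: "P \<in> bool_comb B \<Longrightarrow> - P \<in> bool_comb B"
| bc_inter: "P \<in> bool_comb B \<Longrightarrow> Q \<in> bool_comb B \<Longrightarrow> P \<inter> Q \<in> bool_comb B"
| bc_union: "P \<in> bool_comb B \<Longrightarrow> Q \<in> bool_comb B \<Longrightarrow> P \<union> Q \<in> bool_comb B"

text \<open>The sets \<open>all_var x (an i)\<close> play for \<open>havoc x\<close> the role that substitution instances play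
  for assignments: they are the preconditions in instances of the Havoc rule. They contribute
  nothing unless \<open>havoc x\<close> occurs in \<open>c\<close>.\<close>

definition derived ::
  "('o, 'r) interp \<Rightarrow> ('o, 'r) cmd \<Rightarrow> label \<Rightarrow> (label \<Rightarrow> assertion) \<Rightarrow> var \<Rightarrow> assertion set" where
  "derived I c f an pc =
     bool_comb (an ` ctrl (aut I c f) \<union> bset I ` bexps c
                \<union> {bset I (BPrim (Eq (Var pc) (Num n))) | n. True})
     \<union> {subst I (an i) x e | i x e n. i \<in> ctrl (aut I c f) \<and> Asgn n x e \<in> subcmds c}
     \<union> {all_var x (an i) | i x n. i \<in> ctrl (aut I c f) \<and> Havoc n x \<in> subcmds c}"

end

theory Submission
  imports Defs
begin

text \<open>A valid annotation of the automaton of \<open>c\<close> restricts to a valid annotation of the automaton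
  of every component \<open>d\<close> of \<open>c\<close>, provided the final label of the latter is the label at which
  \<open>c\<close> continues after \<open>d\<close>. Hence \<open>d : {an (lab d)} {an g}\<close>, with \<open>g\<close> that continuation label, is
  derivable by structural induction: the annotation at the second component is the intermediate
  assertion of a sequence, the annotation at the label of a loop is its invariant, and the
  transitions of the automaton are exactly the inclusions needed for the consequence rule.\<close>

section \<open>Labels and the subcommands that bear them\<close>

lemma lab_in_labs: "lab c \<in> labs c"
  by (induction c) (auto simp: labs_def)

lemma labs_simps [simp]:
  "labs (Skip n) = {n}"
  "labs (Asgn n x e) = {n}"
  "labs (Havoc n x) = {n}"
  "labs (Seq c d) = labs c \<union> labs d"
  "labs (IfFi n gcs) = insert n (\<Union>(e, c) \<in> set gcs. labs c)"
  "labs (DoOd n gcs) = insert n (\<Union>(e, c) \<in> set gcs. labs c)"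
  by (auto simp: labs_def)

lemma subcmds_refl: "c \<in> subcmds c"
  by (cases c) auto

lemma lab_subcmd_in_labs: "d \<in> subcmds c \<Longrightarrow> lab d \<in> labs c"
proof (induction c rule: subcmds.induct)
  case (5 n gcs)
  then show ?case
    by (cases "d = IfFi n gcs") (simp, simp, blast)
next
  case (6 n gcs)
  then show ?case
    by (cases "d = DoOd n gcs") (simp, simp, blast)
qed (auto simp: lab_in_labs)

text \<open>Existence half of the description in \<open>sub\<close>. A label of a sequence is found
  inside one of its components, so the witness need not be a \<open>Seq\<close>.\<close>

lemma ex_subcmd_with_label: "n \<in> labs c \<Longrightarrow> \<exists>d \<in> subcmds c. \<not> is_seq d \<and> lab d = n"
proof (induction c rule: subcmds.induct)
  case (4 c d)
  then show ?case
    by simp blast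
next
  case (5 m gcs)
  then show ?case
    by (cases "n = m") (simp, simp, blast)
next
  case (6 m gcs)
  then show ?case
    by (cases "n = m") (simp, simp, blast)
qed auto

text \<open>Bodies of different branches share no label, so a label selects its body; the first body
  in which \<open>fsuc_gcs\<close> finds \<open>m\<close> is therefore \<open>c\<close>.\<close>

lemma distinct_concat_gcs:
  assumes "distinct (concat (map (\<lambda>(e, c). label_list c) gcs))" "(e, c) \<in> set gcs"
  shows "distinct (label_list c)"
    and "(e', c') \<in> set gcs \<Longrightarrow> m \<in> labs c \<Longrightarrow> m \<in> labs c' \<Longrightarrow> c' = c"
    and "m \<in> labs c \<Longrightarrow> fsuc_gcs m gcs f = fsuc m c f"
  using assms by (induction gcs) (auto 0 4 simp: labs_def)

text \<open>Treats \<open>IfFi\<close> and \<open>DoOd\<close> at once, with \<open>k\<close>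
  standing for either. The label of \<open>k\<close> occurs in no body, and two subcommands of
  bodies with a common label lie in the same body, where the induction hypothesis \<open>IH\<close>
  applies.\<close>

lemma subcmd_unique_gcs:
  fixes gcs :: "('o, 'r) gcs"
  assumes dist: "distinct (lab k # concat (map (\<lambda>(e, c). label_list c) gcs))"
    and d: "d \<in> {k} \<union> (\<Union>(e, c) \<in> set gcs. subcmds c)"
    and d': "d' \<in> {k} \<union> (\<Union>(e, c) \<in> set gcs. subcmds c)"
    and lab: "lab d = lab d'"
    and IH: "\<And>e b. (e, b) \<in> set gcs \<Longrightarrow> distinct (label_list b) \<Longrightarrow>
      d \<in> subcmds b \<Longrightarrow> d' \<in> subcmds b \<Longrightarrow> d = d'"
  shows "d = d'"
proof -
  have dist': "distinct (concat (map (\<lambda>(e, c). label_list c) gcs))"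
    using dist by simp
  have notin: "lab x \<noteq> lab k" if "(e, b) \<in> set gcs" "x \<in> subcmds b" for x e b
    using dist that(1) lab_subcmd_in_labs[OF that(2)] by (auto simp: labs_def)
  show ?thesis
  proof (cases "d = k \<or> d' = k")
    case True
    then show ?thesis
      using d d' lab notin by (auto; metis)
  next
    case False
    with d d' obtain e b e' b' where
      b: "(e, b) \<in> set gcs" "d \<in> subcmds b" and b': "(e', b') \<in> set gcs" "d' \<in> subcmds b'"
      by auto
    have "b' = b"
      using distinct_concat_gcs(2)[OF dist' b(1) b'(1)] lab_subcmd_in_labs[OF b(2)]
        lab_subcmd_in_labs[OF b'(2)] lab by simp
    with IH b b' distinct_concat_gcs(1)[OF dist' b(1)] show ?thesis
      by blast
  qed
qed

text \<open>Uniqueness half of the description in \<open>sub\<close>. Sequences are excluded because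
  \<open>Seq c d\<close> has the same label as \<open>c\<close>.\<close>

lemma subcmd_unique:
  assumes "distinct (label_list c)" "d \<in> subcmds c" "d' \<in> subcmds c"
    and "\<not> is_seq d" "\<not> is_seq d'" "lab d = lab d'"
  shows "d = d'"
  using assms
proof (induction c rule: subcmds.induct)
  case (4 c1 c2)
  have disj: "labs c1 \<inter> labs c2 = {}"
    using "4.prems"(1) by (auto simp: labs_def)
  show ?case
    using 4 disj lab_subcmd_in_labs[of d] lab_subcmd_in_labs[of d']
    by (auto simp: disjoint_iff)
next
  case (5 n gcs)
  show ?case
    by (rule subcmd_unique_gcs[of "IfFi n gcs" gcs]) (use 5 in auto)
next
  case (6 n gcs)
  show ?case
    by (rule subcmd_unique_gcs[of "DoOd n gcs" gcs]) (use 6 in auto)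
qed auto

lemma sub_eqI:
  assumes "okf c f" "d \<in> subcmds c" "\<not> is_seq d" "lab d = n"
  shows "sub n c = d"
  unfolding sub_def
proof (rule the_equality)
  show "d \<in> subcmds c \<and> \<not> is_seq d \<and> lab d = n"
    using assms by simp
  show "d' = d" if "d' \<in> subcmds c \<and> \<not> is_seq d' \<and> lab d' = n" for d'
    using subcmd_unique[of c d' d] assms that by (auto simp: okf_def)
qed

lemma sub_self: "okf c f \<Longrightarrow> \<not> is_seq c \<Longrightarrow> sub (lab c) c = c"
  by (rule sub_eqI[OF _ subcmds_refl]) auto

section \<open>Restriction of a valid annotation to a component\<close>

lemma valid_annotationD:
  assumes "valid_annotation (aut I c f) an" "aut_step I c f (n, s) (m, t)"
    and "m \<in> labs c \<union> {f}" "s \<in> an n"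
  shows "t \<in> an m"
proof -
  have "n \<in> labs c"
    using assms(2) by (auto simp: aut_step_def)
  with assms(2-4) show ?thesis
    using assms(1)[unfolded valid_annotation_def, rule_format, of n m s t] by (simp add: aut_def)
qed

text \<open>\<open>sub\<close> and \<open>fsuc\<close> agree for \<open>d\<close> and
  \<open>c\<close> on the labels of \<open>d\<close>, so every transition of the component automaton
  is one of the whole automaton. The exit \<open>g\<close> may be an inner control point of
  \<open>c\<close>.\<close>

lemma valid_annotation_component:
  assumes "okf c f" "okf d g" "subcmds d \<subseteq> subcmds c"
    and sub_labs: "labs d \<union> {g} \<subseteq> labs c \<union> {f}"
    and fsuc: "\<And>m. m \<in> labs d \<Longrightarrow> fsuc m c f = fsuc m d g"
    and valid: "valid_annotation (aut I c f) an"
  shows "valid_annotation (aut I d g) an"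
proof -
  have "t \<in> an m"
    if "m \<in> labs d \<union> {g}" "s \<in> an n" and step: "aut_step I d g (n, s) (m, t)" for n m s t
  proof -
    have n: "n \<in> labs d"
      using step by (auto simp: aut_step_def)
    moreover from n have "n \<in> labs c"
      using assms(3) ex_subcmd_with_label lab_subcmd_in_labs by blast
    \<comment> \<open>\<open>k\<close> is a subcommand of \<open>d\<close> and hence of
      \<open>c\<close>, so both lookups of \<open>n\<close> return it.\<close>
    moreover obtain k where "k \<in> subcmds d" "\<not> is_seq k" "lab k = n"
      using ex_subcmd_with_label[OF n] by blast
    then have "sub n c = sub n d"
      using assms(1-3) sub_eqI by (metis subsetD)
    ultimately have "aut_step I c f (n, s) (m, t)"
      using step fsuc[OF n] by (simp add: aut_step_def)
    with valid show ?thesis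
      by (rule valid_annotationD) (use that sub_labs in auto)
  qed
  then show ?thesis
    unfolding valid_annotation_def aut_def automaton.select_convs by blast
qed

section \<open>Assertions derived from the annotation\<close>

lemma bool_comb_mono:
  assumes "A \<subseteq> B"
  shows "bool_comb A \<subseteq> bool_comb B"
proof
  fix P assume "P \<in> bool_comb A"
  then show "P \<in> bool_comb B"
    by induction (use assms in \<open>auto intro: bool_comb.intros\<close>)
qed

lemma derived_component:
  assumes "subcmds d \<subseteq> subcmds c" "bexps d \<subseteq> bexps c" "labs d \<union> {g} \<subseteq> labs c \<union> {f}"
  shows "derived I d g an pc \<subseteq> derived I c f an pc"
  unfolding derived_def
proof (intro Un_mono bool_comb_mono image_mono order_refl)
  show "ctrl (aut I d g) \<subseteq> ctrl (aut I c f)"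
    using assms(3) by (simp add: aut_def)
qed (use assms in \<open>auto simp: aut_def; blast\<close>)+

lemma bsubexps_refl: "b \<in> bsubexps b"
  by (cases b) auto

text \<open>\<open>bexps\<close> collects the guards but in general not their disjunction, so the
  set of \<open>enab\<close> has to be built as a union.\<close>

lemma bool_comb_enab:
  assumes "gcs \<noteq> []" "bset I ` fst ` set gcs \<subseteq> bool_comb B"
  shows "bset I (enab gcs) \<in> bool_comb B"
  using assms
proof (induction gcs rule: enab.induct)
  case (3 e c gc gcs)
  have "bset I (enab ((e, c) # gc # gcs)) = bset I e \<union> bset I (enab (gc # gcs))"
    by (auto simp: bset_def)
  with 3 show ?case
    by (auto intro: bc_union)
qed auto

lemma annot_in_derived:
  assumes "i \<in> labs c \<union> {f}"
  shows "an i \<in> derived I c f an pc"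
  unfolding derived_def by (intro UnI1 bc_base) (use assms in \<open>auto simp: aut_def\<close>)

lemma annot_guard_in_derived:
  assumes "i \<in> labs c \<union> {f}" "b \<in> bexps c"
  shows "an i \<inter> bset I b \<in> derived I c f an pc"
proof -
  let ?B = "an ` ctrl (aut I c f) \<union> bset I ` bexps c
    \<union> {bset I (BPrim (Eq (Var pc) (Num n))) | n. True}"
  have "an i \<in> bool_comb ?B" "bset I b \<in> bool_comb ?B"
    using assms by (auto simp: aut_def intro!: bc_base)
  then show ?thesis
    unfolding derived_def by (intro UnI1 bc_inter)
qed

lemma subst_in_derived:
  assumes "i \<in> labs c \<union> {f}" "Asgn n x e \<in> subcmds c"
  shows "subst I (an i) x e \<in> derived I c f an pc"
  unfolding derived_def by (rule UnI1, rule UnI2) (use assms in \<open>auto simp: aut_def; blast\<close>)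

lemma all_var_in_derived:
  assumes "i \<in> labs c \<union> {f}" "Havoc n x \<in> subcmds c"
  shows "all_var x (an i) \<in> derived I c f an pc"
  unfolding derived_def by (rule UnI2) (use assms in \<open>auto simp: aut_def; blast\<close>)

lemma annot_not_enab_in_derived:
  assumes "i \<in> labs c \<union> {f}" "gcs \<noteq> []" "fst ` set gcs \<subseteq> bexps c"
  shows "an i \<inter> - bset I (enab gcs) \<in> derived I c f an pc"
  unfolding derived_def
  by (intro UnI1 bc_inter bc_compl bool_comb_enab)
    (use assms in \<open>auto simp: aut_def image_image intro!: bc_base\<close>)

section \<open>Derivation by structural induction\<close>

text \<open>The exit \<open>f\<close> varies, since each component has its own continuation.
  \<open>A\<close> stays fixed above all derived sets, so that the derivations for components
  combine without change.\<close>

lemma hlp_of_valid_annotation: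
  assumes "wf_cmd I c" "okf c f" "valid_annotation (aut I c f) an" "derived I c f an pc \<subseteq> A"
  shows "hlp I A c (an (lab c)) (an f)"
  using assms
proof (induction c arbitrary: f rule: subcmds.induct)
  case (1 n)
  \<comment> \<open>A skip moves to \<open>f\<close> with the store unchanged.\<close>
  have sub: "an n \<subseteq> an f"
    using valid_annotationD[OF "1.prems"(3)] sub_self[OF "1.prems"(2)]
    by (auto simp: aut_step_def)
  have A: "an n \<in> A" "an f \<in> A"
    by (rule subsetD[OF "1.prems"(4)], simp add: annot_in_derived)+
  show ?case
    using hlp_conseq[OF A(1,2) sub hlp_skip[OF A(2)] order_refl] by simp
next
  case (2 n x e)
  \<comment> \<open>Positivity makes the label of the residual \<open>Skip (- n)\<close> negative,
    which \<open>aut_step\<close> reads as termination: control passes to \<open>fsuc\<close>, here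
    \<open>f\<close>.\<close>
  have "n > 0"
    using "2.prems"(2) by (simp add: okf_def)
  then have sub: "an n \<subseteq> subst I (an f) x e"
    using valid_annotationD[OF "2.prems"(3)] sub_self[OF "2.prems"(2)]
    by (fastforce simp: aut_step_def subst_def intro: step_asgn)
  have A: "an n \<in> A" "an f \<in> A" "subst I (an f) x e \<in> A"
    by (rule subsetD[OF "2.prems"(4)], auto intro: annot_in_derived subst_in_derived)+
  show ?case
    using hlp_conseq[OF A(1,2) sub hlp_asgn[OF A(3,2)] order_refl] by simp
next
  case (3 n x)
  have "n > 0"
    using "3.prems"(2) by (simp add: okf_def)
  \<comment> \<open>There is one transition for each value of \<open>x\<close>, which gives the
    universal quantifier.\<close>
  then have sub: "an n \<subseteq> all_var x (an f)"
    using valid_annotationD[OF "3.prems"(3)] sub_self[OF "3.prems"(2)]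
    by (fastforce simp: aut_step_def all_var_def intro: step_havoc)
  have A: "an n \<in> A" "an f \<in> A" "all_var x (an f) \<in> A"
    by (rule subsetD[OF "3.prems"(4)], auto intro: annot_in_derived all_var_in_derived)+
  show ?case
    using hlp_conseq[OF A(1,2) sub hlp_havoc[OF A(3,2)] order_refl] by simp
next
  case (4 c d)
  \<comment> \<open>Control leaves \<open>c\<close> at \<open>lab d\<close>, which by distinctness
    is no label of \<open>c\<close> and so can serve as its exit.\<close>
  have disj: "labs c \<inter> labs d = {}"
    and ok: "okf c (lab d)" "okf d f"
    using "4.prems"(2) lab_in_labs[of d] by (auto simp: okf_def labs_def)
  have "hlp I A c (an (lab c)) (an (lab d))"
  proof (rule "4.IH"(1))
    show "valid_annotation (aut I c (lab d)) an"
      by (rule valid_annotation_component[OF "4.prems"(2) ok(1) _ _ _ "4.prems"(3)])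
        (auto simp: lab_in_labs)
    show "derived I c (lab d) an pc \<subseteq> A"
      by (rule order_trans[OF derived_component "4.prems"(4)]) (auto simp: lab_in_labs)
  qed (use "4.prems"(1) ok in auto)
  moreover have "hlp I A d (an (lab d)) (an f)"
  proof (rule "4.IH"(2))
    \<comment> \<open>\<open>fsuc\<close> tests membership in \<open>labs c\<close> first;
      disjointness sends labels of \<open>d\<close> to the other clause.\<close>
    show "valid_annotation (aut I d f) an"
      by (rule valid_annotation_component[OF "4.prems"(2) ok(2) _ _ _ "4.prems"(3)])
        (use disj in auto)
    show "derived I d f an pc \<subseteq> A"
      by (rule order_trans[OF derived_component "4.prems"(4)]) auto
  qed (use "4.prems"(1) ok in auto)
  ultimately show ?case
    unfolding lab.simps by (rule hlp_seq)
next
  case (5 n gcs)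
  have dist: "distinct (concat (map (\<lambda>(e, c). label_list c) gcs))"
    using "5.prems"(2) by (simp add: okf_def)
  have "hlp I A b (an n \<inter> bset I e) (an f)" if gc: "(e, b) \<in> set gcs" for e b
  proof (rule hlp_conseq)
    have ok: "okf b f" and n: "n \<notin> labs b"
      using "5.prems"(2) gc distinct_concat_gcs(1)[OF dist gc] by (auto simp: okf_def labs_def)
    show "an n \<inter> bset I e \<in> A"
      using gc bsubexps_refl by (intro subsetD[OF "5.prems"(4)] annot_guard_in_derived) auto
    show "an f \<in> A"
      by (intro subsetD[OF "5.prems"(4)] annot_in_derived) auto
    \<comment> \<open>With \<open>lab b\<close> positive, choosing a branch counts as a move to
      \<open>lab b\<close> and not as termination.\<close>
    have b: "lab b \<in> labs (IfFi n gcs)" "lab b > 0"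
      using gc lab_in_labs[of b] ok by (auto simp: okf_def)
    show "an n \<inter> bset I e \<subseteq> an (lab b)"
    proof
      fix s assume s: "s \<in> an n \<inter> bset I e"
      then have "aut_step I (IfFi n gcs) f (n, s) (lab b, s)"
        using b sub_self[OF "5.prems"(2)] step_if[OF gc] by (auto simp: aut_step_def bset_def)
      with "5.prems"(3) show "s \<in> an (lab b)"
        by (rule valid_annotationD) (use b s in auto)
    qed
    show "hlp I A b (an (lab b)) (an f)"
    proof (rule "5.IH"[OF gc refl])
      show "valid_annotation (aut I b f) an"
        by (rule valid_annotation_component[OF "5.prems"(2) ok _ _ _ "5.prems"(3)])
          (use gc n distinct_concat_gcs(3)[OF dist gc] in auto)
      show "derived I b f an pc \<subseteq> A"
        by (rule order_trans[OF derived_component "5.prems"(4)]) (use gc in auto)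
    qed (use "5.prems"(1) gc ok in auto)
  qed simp
  moreover have "an n \<in> A" "an f \<in> A"
    by (rule subsetD[OF "5.prems"(4)], simp add: annot_in_derived)+
  ultimately show ?case
    unfolding lab.simps using "5.prems"(1) by (intro hlp_if)
next
  case (6 n gcs)
  have dist: "distinct (concat (map (\<lambda>(e, c). label_list c) gcs))" and "n > 0"
    using "6.prems"(2) by (auto simp: okf_def)
  have body: "hlp I A b (bset I e \<inter> an n) (an n)" if gc: "(e, b) \<in> set gcs" for e b
  proof (rule hlp_conseq)
    \<comment> \<open>After the body, control returns to the loop, so the exit of the body is
      \<open>n\<close>.\<close>
    have ok: "okf b n"
      using "6.prems"(2) gc distinct_concat_gcs(1)[OF dist gc] by (auto simp: okf_def labs_def)
    show "bset I e \<inter> an n \<in> A"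
      \<comment> \<open>The Do rule writes the guard first, the If rule second; the membership lemma
        follows the latter.\<close>
      unfolding Int_commute[of "bset I e"]
      using gc bsubexps_refl by (intro subsetD[OF "6.prems"(4)] annot_guard_in_derived) auto
    show "an n \<in> A"
      by (intro subsetD[OF "6.prems"(4)] annot_in_derived) auto
    have b: "lab b \<in> labs (DoOd n gcs)" "lab b > 0"
      using gc lab_in_labs[of b] "6.prems"(2) by (auto simp: okf_def)
    show "bset I e \<inter> an n \<subseteq> an (lab b)"
    proof
      fix s assume s: "s \<in> bset I e \<inter> an n"
      \<comment> \<open>The unfolded loop begins with the body, hence its label is
        \<open>lab b\<close>.\<close>
      then have "step I (DoOd n gcs, s) (Seq b (DoOd n gcs), s)"
        by (intro step_do[OF gc]) (simp add: bset_def)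
      then have "aut_step I (DoOd n gcs) f (n, s) (lab b, s)"
        using b sub_self[OF "6.prems"(2)] by (force simp: aut_step_def)
      with "6.prems"(3) show "s \<in> an (lab b)"
        by (rule valid_annotationD) (use b s in auto)
    qed
    show "hlp I A b (an (lab b)) (an n)"
    proof (rule "6.IH"[OF gc refl])
      show "valid_annotation (aut I b n) an"
        by (rule valid_annotation_component[OF "6.prems"(2) ok _ _ _ "6.prems"(3)])
          (use gc ok distinct_concat_gcs(3)[OF dist gc] in \<open>auto simp: okf_def\<close>)
      show "derived I b n an pc \<subseteq> A"
        by (rule order_trans[OF derived_component "6.prems"(4)]) (use gc in auto)
    qed (use "6.prems"(1) gc ok in auto)
  qed simp
  \<comment> \<open>The transition taken when all guards fail; it weakens the postcondition of the
    Do rule to \<open>an f\<close>.\<close>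
  have exit: "an n \<inter> - bset I (enab gcs) \<subseteq> an f"
  proof
    fix s assume s: "s \<in> an n \<inter> - bset I (enab gcs)"
    then have "step I (DoOd n gcs, s) (Skip (- n), s)"
      by (intro step_do_end) (simp add: bset_def)
    then have "aut_step I (DoOd n gcs) f (n, s) (f, s)"
      using \<open>n > 0\<close> sub_self[OF "6.prems"(2)] by (force simp: aut_step_def)
    with "6.prems"(3) show "s \<in> an f"
      by (rule valid_annotationD) (use s in auto)
  qed
  have "fst ` set gcs \<subseteq> bexps (DoOd n gcs)"
    using bsubexps_refl by fastforce
  then have "an n \<inter> - bset I (enab gcs) \<in> A"
    using "6.prems"(1)
    by (intro subsetD[OF "6.prems"(4)] annot_not_enab_in_derived) auto
  moreover have A: "an n \<in> A" "an f \<in> A"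
    by (rule subsetD[OF "6.prems"(4)], simp add: annot_in_derived)+
  ultimately have "hlp I A (DoOd n gcs) (an n) (an n \<inter> - bset I (enab gcs))"
    using "6.prems"(1) body by (intro hlp_do)
  then show ?case
    using hlp_conseq[OF A order_refl _ exit] by simp
qed

theorem theorem5p13:
  fixes I :: "('o, 'r) interp" and c :: "('o, 'r) cmd" and f :: label
    and an :: "label \<Rightarrow> assertion" and P Q :: assertion and pc :: var
  assumes "wf_cmd I c"
    and "okf c f"
    and "annotation (aut I c f) an P Q"
    and "valid_annotation (aut I c f) an"
    and "pc \<notin> cvars c"
  shows "hlp I (derived I c f an pc) c P Q"
  using hlp_of_valid_annotation[OF assms(1,2,4) order_refl] assms(3)
  by (simp add: annotation_def aut_def)

end
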